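(* Let $G=(V,E)$ be a cubic $3$-edge-connected graph with $n=|V|$ (with $V$ identified with $V_n$), and let $f\in\mathbb{R}^V_+$ be node weights. Define $c\in\mathbb{R}^{E_n}$ by $c_{uv}=f_u+f_v$ if $uv\in E$, and otherwise $c_{uv}$ equal to the minimum cost of a $u$–$v$ path in $G$, where each edge $ab\in E$ has cost $f_a+f_b$. If the everywhere $\lambda$ vector for $G$ is in $T^n$, then $OPT(c)\le\frac32\lambda\, LP(c)$.
   Context: $K_n=(V_n,E_n)$ is the complete graph on $n$ nodes. For $U\subseteq V_n$, $\delta(U)$ is the set of edges with exactly one endpoint in $U$, $x(F)=\sum_{e\in F}x_e$. $S^n=\{x\in\mathbb{R}^{E_n}: x(\delta(v))=2 \ \forall v,\ x(\delta(S))\ge 2\ \forall \emptyset\ne S\subsetneq V_n,\ 0\le x\le 1\}$, $LP(c)=\min\{cx:x\in S^n\}$, and $OPT(c)$ is the minimum cost of a Hamiltonian cycle of $K_n$. The everywhere $\lambda$ vector for $G$ is $y\in\mathbb{R}^{E_n}$ with $y_e=\lambda$ for $e\in E$ and $y_e=0$ otherwise. A tour is a multiset $J$ of edges of $K_n$ with $(V_n,J)$ connected and all degrees even; $T^n$ is the convex hull of incidence vectors (with multiplicities) of all tours of $K_n$. *)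

theory Defs
  imports "HOL-Analysis.Analysis" "HOL-Library.Multiset"
begin

text \<open>
  The node set \<open>V\<^sub>n\<close> is the universe of a finite type \<^typ>\<open>'v\<close>, so \<open>n = CARD('v)\<close>; edges are
  two-element node sets.  The space of real vectors indexed by \<open>E\<^sub>n\<close> is the coordinate subspace of
  \<^typ>\<open>real ^ 'v set\<close> of vectors vanishing outside \<open>E\<^sub>n\<close>.
\<close>

definition K_edges :: "'v::finite set set" where
  "K_edges = {e. card e = 2}"

definition cut :: "'v::finite set \<Rightarrow> 'v set set" where
  "cut U = {e \<in> K_edges. card (e \<inter> U) = 1}"

definition vsum :: "real ^ ('v::finite set) \<Rightarrow> 'v set set \<Rightarrow> real" where
  "vsum x F = (\<Sum>e\<in>F. x $ e)"

fun walk_edges :: "'v list \<Rightarrow> 'v set list" where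
  "walk_edges (u # v # p) = {u, v} # walk_edges (v # p)"
| "walk_edges p = []"

definition is_path :: "'v set set \<Rightarrow> 'v \<Rightarrow> 'v list \<Rightarrow> 'v \<Rightarrow> bool" where
  "is_path F u p v \<longleftrightarrow>
     p \<noteq> [] \<and> hd p = u \<and> last p = v \<and> distinct p \<and> set (walk_edges p) \<subseteq> F"

definition graph_connected :: "'v set set \<Rightarrow> bool" where
  "graph_connected F \<longleftrightarrow> (\<forall>u v. \<exists>p. is_path F u p v)"

definition edge_connected :: "nat \<Rightarrow> 'v::finite set set \<Rightarrow> bool" where
  "edge_connected k E \<longleftrightarrow> (\<forall>F \<subseteq> E. card F < k \<longrightarrow> graph_connected (E - F))"

definition cubic :: "'v::finite set set \<Rightarrow> bool" where
  "cubic E \<longleftrightarrow> (\<forall>v. card {e \<in> E. v \<in> e} = 3)"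

definition subtour_polytope :: "(real ^ ('v::finite set)) set" where
  "subtour_polytope =
     {x. (\<forall>e. e \<notin> K_edges \<longrightarrow> x $ e = 0) \<and>
         (\<forall>v. vsum x (cut {v}) = 2) \<and>
         (\<forall>S. S \<noteq> {} \<and> S \<subset> UNIV \<longrightarrow> vsum x (cut S) \<ge> 2) \<and>
         (\<forall>e\<in>K_edges. 0 \<le> x $ e \<and> x $ e \<le> 1)}"

definition LP :: "real ^ ('v::finite set) \<Rightarrow> real" where
  "LP c = (LEAST r. \<exists>x \<in> subtour_polytope. r = (\<Sum>e\<in>K_edges. c $ e * x $ e))"

definition hamiltonian_cycle :: "'v set set \<Rightarrow> bool" where
  "hamiltonian_cycle H \<longleftrightarrow>
     (\<exists>p. length p \<ge> 3 \<and> distinct p \<and> set p = UNIV \<and> H = set (walk_edges (p @ [hd p])))"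

definition OPT :: "real ^ ('v::finite set) \<Rightarrow> real" where
  "OPT c = Min {vsum c H | H. hamiltonian_cycle H}"

definition everywhere :: "real \<Rightarrow> 'v::finite set set \<Rightarrow> real ^ 'v set" where
  "everywhere l E = (\<chi> e. if e \<in> E then l else 0)"

definition is_tour :: "'v::finite set multiset \<Rightarrow> bool" where
  "is_tour J \<longleftrightarrow>
     set_mset J \<subseteq> K_edges \<and> graph_connected (set_mset J) \<and>
     (\<forall>v. even (size {#e \<in># J. v \<in> e#}))"

definition incidence_vector :: "'v::finite set multiset \<Rightarrow> real ^ 'v set" where
  "incidence_vector J = (\<chi> e. real (count J e))"

definition tour_polyhedron :: "(real ^ ('v::finite set)) set" where
  "tour_polyhedron = convex hull {incidence_vector J | J. is_tour J}"

definition path_cost :: "('v \<Rightarrow> real) \<Rightarrow> 'v list \<Rightarrow> real" where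
  "path_cost f p = (\<Sum>e\<leftarrow>walk_edges p. \<Sum>v\<in>e. f v)"

definition node_weight_cost :: "'v::finite set set \<Rightarrow> ('v \<Rightarrow> real) \<Rightarrow> real ^ 'v set" where
  "node_weight_cost E f =
     (\<chi> e. if e \<in> E then (\<Sum>v\<in>e. f v)
           else if e \<in> K_edges then Min {path_cost f p | u v p. e = {u, v} \<and> is_path E u p v}
           else 0)"

end

theory Submission
  imports Defs "HOL-Library.Sublist"
begin

text \<open>
  Every edge satisfies \<open>c\<^sub>u\<^sub>v \<ge> f\<^sub>u + f\<^sub>v\<close>, with equality on \<open>E\<close>. So the degree equations give
  \<open>cx \<ge> 2 \<Sum>\<^sub>v f\<^sub>v\<close> on the subtour polytope, and the everywhere \<open>2/3\<close> vector, which is feasible by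
  3-edge-connectivity, attains this value: \<open>LP(c) = 2 \<Sum>\<^sub>v f\<^sub>v\<close>. The everywhere \<open>\<lambda>\<close> vector costs
  \<open>3\<lambda> \<Sum>\<^sub>v f\<^sub>v\<close>, hence some tour costs no more. As \<open>c\<close> is a path metric, shortcutting an Eulerian
  closed walk of that tour yields a Hamiltonian cycle of at most the same cost.
\<close>

section \<open>Walks\<close>

text \<open>The edge weight is a parameter, so that the same lemmas serve \<open>sum f\<close> on
  paths of the graph and the metric \<open>($) c\<close> on closed trails.\<close>

definition walk_weight :: "('v set \<Rightarrow> real) \<Rightarrow> 'v list \<Rightarrow> real" where
  "walk_weight w p = (\<Sum>e\<leftarrow>walk_edges p. w e)"

lemma walk_weight_simps [simp]:
  "walk_weight w [] = 0"
  "walk_weight w [u] = 0"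
  "walk_weight w (u # v # p) = w {u, v} + walk_weight w (v # p)"
  by (simp_all add: walk_weight_def)

lemma path_cost_eq_walk_weight: "path_cost f p = walk_weight (sum f) p"
  by (simp add: path_cost_def walk_weight_def)

lemma walk_edges_append:
  "walk_edges (p @ v # q) = walk_edges (p @ [v]) @ walk_edges (v # q)"
proof (induction p)
  case (Cons a p)
  then show ?case by (cases p) auto
qed simp

lemma walk_edges_snoc: "p \<noteq> [] \<Longrightarrow> walk_edges (p @ [v]) = walk_edges p @ [{last p, v}]"
  by (induction p rule: walk_edges.induct) auto

lemma walk_edges_rev: "walk_edges (rev p) = rev (walk_edges p)"
proof (induction p rule: walk_edges.induct)
  case (1 u v p)
  then show ?case
    using walk_edges_append[of "rev p" v "[u]"] by (simp add: insert_commute)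
qed auto

lemma length_walk_edges: "length (walk_edges p) = length p - 1"
  by (induction p rule: walk_edges.induct) auto

lemma walk_weight_append:
  "walk_weight w (p @ v # q) = walk_weight w (p @ [v]) + walk_weight w (v # q)"
  by (simp add: walk_weight_def walk_edges_append[of p v q])

lemma walk_weight_nonneg: "(\<And>e. w e \<ge> 0) \<Longrightarrow> walk_weight w p \<ge> 0"
  unfolding walk_weight_def by (rule sum_list_nonneg) auto

text \<open>Between two occurrences of a node the walk is closed and can be cut out. With
  nonnegative weights this never raises the weight, and it strictly shortens the walk.\<close>

lemma walk_to_path:
  assumes "p \<noteq> []" "set (walk_edges p) \<subseteq> F" "\<And>e. w e \<ge> 0"
  shows "\<exists>q. is_path F (hd p) q (last p) \<and> walk_weight w q \<le> walk_weight w p"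
  using assms(1,2)
proof (induction p rule: length_induct)
  case (1 p)
  show ?case
  proof (cases "distinct p")
    case True
    then show ?thesis using 1 by (auto simp: is_path_def)
  next
    case False
    then obtain xs ys zs y where p: "p = xs @ [y] @ ys @ [y] @ zs"
      using not_distinct_decomp by blast
    let ?q = "xs @ y # zs"
    have e: "walk_edges p = walk_edges (xs @ [y]) @ walk_edges (y # ys @ [y]) @ walk_edges (y # zs)"
      using walk_edges_append[of xs y "ys @ y # zs"] walk_edges_append[of "y # ys" y zs]
      by (simp add: p)
    have q: "walk_edges ?q = walk_edges (xs @ [y]) @ walk_edges (y # zs)"
      by (rule walk_edges_append)
    have "set (walk_edges ?q) \<subseteq> F"
      using 1(3) unfolding e q by auto
    moreover have "length ?q < length p" by (simp add: p)
    ultimately obtain r where r: "is_path F (hd ?q) r (last ?q)" "walk_weight w r \<le> walk_weight w ?q"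
      using 1(1) by blast
    have "walk_weight w ?q \<le> walk_weight w p"
      using walk_weight_nonneg[of w "y # ys @ [y]"] assms(3)
      unfolding walk_weight_def e q by simp
    moreover have "hd ?q = hd p" "last ?q = last p"
      unfolding p by (cases xs; simp) (cases zs; simp)
    ultimately show ?thesis using r by auto
  qed
qed

lemma walk_crosses:
  assumes "p \<noteq> []" "hd p \<in> S" "last p \<notin> S"
  shows "\<exists>a b. a \<in> S \<and> b \<notin> S \<and> {a, b} \<in> set (walk_edges p)"
  using assms
proof (induction p rule: walk_edges.induct)
  case (1 u v p)
  then show ?case by (cases "v \<in> S") auto
qed auto

lemma connected_crosses:
  assumes "graph_connected F" "S \<noteq> {}" "S \<noteq> UNIV"
  obtains a b where "a \<in> S" "b \<notin> S" "{a, b} \<in> F"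
proof -
  from assms obtain u v where "u \<in> S" "v \<notin> S" by auto
  moreover from assms(1) obtain p where "is_path F u p v"
    unfolding graph_connected_def by blast
  ultimately show ?thesis
    using walk_crosses[of p S] that unfolding is_path_def by blast
qed

section \<open>Eulerian walks\<close>

abbreviation mdeg :: "'v set multiset \<Rightarrow> 'v \<Rightarrow> nat" where
  "mdeg M v \<equiv> size {#e \<in># M. v \<in> e#}"

lemma K_edges_doubleton [simp]: "{u, v} \<in> K_edges \<longleftrightarrow> u \<noteq> v"
  by (auto simp: K_edges_def card_insert_if)

lemma K_edgesE:
  assumes "e \<in> K_edges" "v \<in> e"
  obtains w where "e = {v, w}" "w \<noteq> v"
  using assms by (auto simp: K_edges_def card_2_iff)

text \<open>Each passage through a node uses two edge ends, so only the two ends of the walk can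
  have odd degree, and these cancel when they coincide. Edges in \<open>K_edges\<close> exclude
  loops.\<close>

lemma even_walk_degree:
  assumes "p \<noteq> []" "set (walk_edges p) \<subseteq> K_edges"
  shows "even (mdeg (mset (walk_edges p)) x) \<longleftrightarrow> (x = hd p) = (x = last p)"
  using assms by (induction p rule: walk_edges.induct) auto

lemma closed_trail_exists:
  fixes M :: "'v::finite set multiset"
  assumes "set_mset M \<subseteq> K_edges" "\<And>v. even (mdeg M v)" "{v, w} \<in># M"
  shows "\<exists>q. q \<noteq> [] \<and> last (v # q) = v \<and> mset (walk_edges (v # q)) \<subseteq># M"
proof -
  let ?P = "\<lambda>p. p \<noteq> [] \<and> hd p = v \<and> mset (walk_edges p) \<subseteq># M"
  have bound: "length p \<le> Suc (size M)" if "?P p" for p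
    using size_mset_mono[of "mset (walk_edges p)" M] that by (simp add: length_walk_edges)
  have vw: "?P [v, w]" using assms(3) by simp
  \<comment> \<open>A trail has one node more than edges, hence the first \<open>Suc\<close>; the
    second one makes the bound strict.\<close>
  have "\<exists>p. ?P p \<and> (\<forall>q. ?P q \<longrightarrow> length q \<le> length p)"
    by (rule Lattices_Big.ex_has_greatest_nat[where k = "[v, w]" and b = "Suc (Suc (size M))"])
      (use vw bound in \<open>auto simp: less_Suc_eq_le\<close>)
  then obtain p where p: "?P p" and max: "\<And>q. ?P q \<Longrightarrow> length q \<le> length p" by blast
  have "last p = v"
  proof (rule ccontr)
    assume ne: "last p \<noteq> v"
    let ?R = "M - mset (walk_edges p)"
    have "set (walk_edges p) \<subseteq> K_edges"
      using p assms(1) set_mset_mono[of "mset (walk_edges p)" M] by auto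
    then have "odd (mdeg (mset (walk_edges p)) (last p))"
      using even_walk_degree[of p "last p"] p ne by auto
    moreover have "M = mset (walk_edges p) + ?R" using p by simp
    then have "mdeg M (last p) = mdeg (mset (walk_edges p)) (last p) + mdeg ?R (last p)"
      by (metis filter_union_mset size_union)
    ultimately have "mdeg ?R (last p) \<noteq> 0"
      using assms(2)[of "last p"] by auto
    then obtain e where "e \<in># {#e \<in># ?R. last p \<in> e#}"
      unfolding size_eq_0_iff_empty by (rule multiset_nonemptyE)
    then have e: "e \<in># ?R" "last p \<in> e" by (simp_all only: set_mset_filter mem_Collect_eq)
    then have "e \<in> K_edges" using assms(1) by (meson in_diffD subsetD)
    then obtain z where z: "e = {last p, z}" using e(2) by (rule K_edgesE)
    have "mset (walk_edges p) + {#e#} \<subseteq># mset (walk_edges p) + ?R"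
      using e(1) by (intro subset_mset.add_left_mono) simp
    then have "mset (walk_edges (p @ [z])) \<subseteq># M"
      using p by (simp add: walk_edges_snoc z)
    then have "?P (p @ [z])" using p by simp
    then show False using max[of "p @ [z]"] by simp
  qed
  moreover obtain q where q: "p = v # q" using p by (cases p) auto
  \<comment> \<open>The candidate \<open>[v, w]\<close> rules out the trivial closed trail
    \<open>[v]\<close>.\<close>
  moreover have "length [v, w] \<le> length p" by (rule max) (rule vw)
  then have "q \<noteq> []" unfolding q by (cases q) simp_all
  moreover have "mset (walk_edges p) \<subseteq># M" using p by (elim conjE)
  ultimately show ?thesis by (intro exI[of _ q] conjI) (simp_all only: not_False_eq_True)
qed

lemma spanning_closed_trail:
  assumes "is_tour (J :: 'v::finite set multiset)"
  obtains p where "p \<noteq> []" "hd p = last p" "set p = UNIV" "mset (walk_edges p) \<subseteq># J"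
proof -
  let ?P = "\<lambda>p. p \<noteq> [] \<and> hd p = last p \<and> mset (walk_edges p) \<subseteq># J"
  have bound: "length p \<le> Suc (size J)" if "?P p" for p
    using size_mset_mono[of "mset (walk_edges p)" J] that by (simp add: length_walk_edges)
  \<comment> \<open>A single arbitrary node is a closed trail, so there is something to maximise
    over.\<close>
  have base: "?P [undefined]" by simp
  have "\<exists>p. ?P p \<and> (\<forall>q. ?P q \<longrightarrow> length q \<le> length p)"
    by (rule Lattices_Big.ex_has_greatest_nat[where k = "[undefined]" and b = "Suc (Suc (size J))"])
      (use base bound in \<open>auto simp: less_Suc_eq_le\<close>)
  then obtain p where p: "?P p" and max: "\<And>q. ?P q \<Longrightarrow> length q \<le> length p" by blast
  have "set p = UNIV"
  proof (rule ccontr)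
    assume "set p \<noteq> UNIV"
    then obtain a b where ab: "a \<in> set p" "b \<notin> set p" "{a, b} \<in># J"
      using connected_crosses[of "set_mset J" "set p"] assms p unfolding is_tour_def by auto
    let ?R = "J - mset (walk_edges p)"
    have J: "J = mset (walk_edges p) + ?R" using p by simp
    have K: "set_mset J \<subseteq> K_edges" using assms by (simp add: is_tour_def)
    have pK: "set (walk_edges p) \<subseteq> K_edges"
      using p K set_mset_mono[of "mset (walk_edges p)" J] by auto
    have "even (mdeg ?R v)" for v
    proof -
      have "mdeg J v = mdeg (mset (walk_edges p)) v + mdeg ?R v"
        using J by (metis filter_union_mset size_union)
      moreover have "even (mdeg J v)" using assms by (simp add: is_tour_def)
      ultimately show ?thesis
        using even_walk_degree[OF _ pK, of v] p by auto
    qed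
    moreover have "set_mset ?R \<subseteq> K_edges" using K by (meson in_diffD subset_iff)
    moreover have "{a, b} \<in># ?R"
    proof -
      have "e \<subseteq> set q" if "e \<in> set (walk_edges q)" for e and q :: "'v list"
        using that by (induction q rule: walk_edges.induct) auto
      then have "{a, b} \<notin> set (walk_edges p)" using ab by blast
      then show ?thesis using ab(3) J by (metis set_mset_mset union_iff)
    qed
    ultimately obtain q where q: "q \<noteq> []" "last (a # q) = a" "mset (walk_edges (a # q)) \<subseteq># ?R"
      using closed_trail_exists by metis
    then obtain q' where q': "q = q' @ [a]" by (metis append_butlast_last_id last_ConsR)
    obtain r s where rs: "p = r @ a # s" using ab(1) split_list by metis
    \<comment> \<open>One occurrence of \<open>a\<close> in \<open>p\<close> is replaced by the
      whole detour, which makes the trail strictly longer and keeps its ends.\<close>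
    let ?p = "r @ a # q' @ a # s"
    have "mset (walk_edges ?p) = mset (walk_edges p) + mset (walk_edges (a # q))"
      using walk_edges_append[of r a "q' @ a # s"] walk_edges_append[of "a # q'" a s]
        walk_edges_append[of r a s] by (simp add: rs q')
    then have "mset (walk_edges ?p) \<subseteq># J"
      using q(3) J by (metis mset_subset_eq_mono_add_left_cancel)
    moreover have "hd ?p = hd p" "last ?p = last p"
      unfolding rs by (cases r; simp) (cases s; simp)
    ultimately have "?P ?p" using p by simp
    then show False using max[of ?p] by (simp add: rs)
  qed
  then show ?thesis using that p by blast
qed

section \<open>Shortcutting\<close>

text \<open>Skipping one intermediate node costs at most one triangle inequality. The start
  \<open>a\<close> varies in the induction because it moves along the walk.\<close>

lemma walk_weight_subseq:
  assumes "subseq xs ys"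
    and triangle: "\<And>u v x. w {u, x} \<le> w {u, v} + w {v, x}"
  shows "walk_weight w (a # xs @ [b]) \<le> walk_weight w (a # ys @ [b])"
  using assms(1)
proof (induction arbitrary: a rule: list_emb.induct)
  case (list_emb_Nil ys)
  show ?case
  proof (induction ys arbitrary: a)
    case (Cons y ys)
    show ?case using Cons[of y] triangle[of a b y] by simp
  qed simp
next
  case (list_emb_Cons xs ys y)
  have "walk_weight w (a # xs @ [b]) \<le> w {a, y} + walk_weight w (y # xs @ [b])"
  proof (cases xs)
    case Nil
    then show ?thesis using triangle[of a b y] by simp
  next
    case (Cons x xs')
    then show ?thesis using triangle[of a x y] by simp
  qed
  then show ?case using list_emb_Cons.IH[of y] by simp
next
  case (list_emb_Cons2 x y xs ys)
  then show ?case by simp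
qed

lemma subseq_remdups: "subseq (remdups xs) xs"
  by (induction xs) auto

text \<open>Passes from the edge list of a walk to the edge set that represents a Hamiltonian
  cycle.\<close>

lemma sum_set_le_sum_list:
  fixes w :: "'a \<Rightarrow> real"
  assumes "\<And>x. w x \<ge> 0"
  shows "sum w (set xs) \<le> (\<Sum>x\<leftarrow>xs. w x)"
proof (induction xs)
  case (Cons x xs)
  then show ?case using assms[of x] by (cases "x \<in> set xs") (auto simp: insert_absorb)
qed simp

lemma sum_count_eq_sum_mset:
  fixes w :: "'a::finite \<Rightarrow> real"
  shows "(\<Sum>e\<in>UNIV. w e * real (count J e)) = (\<Sum>e\<in>#J. w e)"
proof (induction J)
  case (add x J)
  have "(\<Sum>e\<in>UNIV. w e * real (count (add_mset x J) e))
      = (\<Sum>e\<in>UNIV. w e * real (count J e) + (if e = x then w e else 0))"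
    by (intro sum.cong) (auto simp: algebra_simps)
  then show ?case using add by (simp add: sum.distrib)
qed simp

text \<open>The closed trail is shortcut to visit each node once. The triangle inequality controls
  the shortcuts, and nonnegativity pays for edges of \<open>J\<close> off the trail.\<close>

lemma OPT_le_tour:
  fixes c :: "real ^ ('v::finite set)"
  assumes "is_tour J" "CARD('v) \<ge> 3"
    and nonneg: "\<And>e. c $ e \<ge> 0"
    and triangle: "\<And>u v x. c $ {u, x} \<le> c $ {u, v} + c $ {v, x}"
  shows "OPT c \<le> c \<bullet> incidence_vector J"
proof -
  obtain p where p: "p \<noteq> []" "hd p = last p" "set p = UNIV" "mset (walk_edges p) \<subseteq># J"
    using spanning_closed_trail[OF assms(1)] by blast
  obtain a r where ar: "p = a # r" using p(1) by (cases p) auto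
  have "r \<noteq> []"
  proof
    assume "r = []"
    then have "UNIV = {a}" using p(3) ar by auto
    then have "CARD('v) = card {a}" by simp
    then show False using assms(2) by simp
  qed
  then obtain q where q: "r = q @ [a]" using p(2) ar by (metis append_butlast_last_id last_ConsR list.sel(1))
  \<comment> \<open>The node \<open>a\<close> is removed because it already starts and ends the
    closed walk; one visit of every other node is kept.\<close>
  define t where "t = remdups (filter (\<lambda>x. x \<noteq> a) q)"
  have sub: "subseq t q"
    unfolding t_def by (rule subseq_order.order_trans[OF subseq_remdups subseq_filter_left])
  have t: "distinct (a # t)" "set (a # t) = UNIV"
    using p(3) by (auto simp: t_def ar q)
  have "length (a # t) = CARD('v)" using distinct_card[OF t(1)] t(2) by simp
  then have "length (a # t) \<ge> 3" using assms(2) by simp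
  then have "hamiltonian_cycle (set (walk_edges (a # t @ [a])))"
    unfolding hamiltonian_cycle_def using t by (intro exI[of _ "a # t"]) auto
  then have "OPT c \<le> vsum c (set (walk_edges (a # t @ [a])))"
    unfolding OPT_def by (intro Min_le) auto
  also have "\<dots> \<le> walk_weight (($) c) (a # t @ [a])"
    unfolding vsum_def walk_weight_def using nonneg by (rule sum_set_le_sum_list)
  also have "\<dots> \<le> walk_weight (($) c) p"
    unfolding ar q using sub triangle by (rule walk_weight_subseq)
  also have "\<dots> = (\<Sum>e\<in>#mset (walk_edges p). c $ e)"
    by (simp add: walk_weight_def sum_mset_sum_list flip: mset_map)
  also have "\<dots> \<le> (\<Sum>e\<in>#J. c $ e)"
  proof -
    obtain R where "J = mset (walk_edges p) + R" using p(4) by (metis subset_mset.add_diff_inverse)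
    moreover have "(\<Sum>e\<in>#R. c $ e) \<ge> 0" using nonneg by (induction R) (auto simp: add_nonneg_nonneg)
    ultimately show ?thesis by simp
  qed
  also have "\<dots> = c \<bullet> incidence_vector J"
    by (simp add: inner_vec_def incidence_vector_def sum_count_eq_sum_mset)
  finally show ?thesis .
qed

section \<open>The node-weight metric\<close>

text \<open>Paths are distinct lists over a finite type. Finiteness is what gives the
  \<open>Min\<close> in \<open>node_weight_cost\<close> its meaning.\<close>

lemma finite_path_costs:
  "finite {path_cost f p | u v p. e = {u, v} \<and> is_path E u p (v :: 'v::finite)}"
proof (rule finite_subset)
  show "{path_cost f p | u v p. e = {u, v} \<and> is_path E u p v} \<subseteq>
    path_cost f ` {p. set p \<subseteq> UNIV \<and> distinct p}"
    by (auto simp: is_path_def)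
  show "finite (path_cost f ` {p :: 'v list. set p \<subseteq> UNIV \<and> distinct p})"
    by (intro finite_imageI finite_subset_distinct) simp
qed

text \<open>The first edge pays for the head and the last edge for the last node; a single edge pays
  for both, as it is no loop.\<close>

lemma walk_weight_ge_ends:
  fixes f :: "'v::finite \<Rightarrow> real"
  assumes "length p \<ge> 2" "set (walk_edges p) \<subseteq> K_edges" "\<And>v. f v \<ge> 0"
  shows "walk_weight (sum f) p \<ge> f (hd p) + f (last p)"
  using assms(1,2)
proof (induction p rule: walk_edges.induct)
  case (1 u v p)
  then show ?case using assms(3)[of v] by (cases p) auto
qed auto

context
  fixes E :: "'v::finite set set" and f :: "'v \<Rightarrow> real"
  assumes EK: "E \<subseteq> K_edges" and conn: "graph_connected E" and f0: "\<And>v. f v \<ge> 0"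
begin

text \<open>Since \<open>{u, u}\<close> is a singleton, this is the zero distance from a node to
  itself, which lets the metric lemmas cover coinciding nodes.\<close>

lemma node_weight_cost_singleton: "node_weight_cost E f $ {u} = 0"
  using EK by (auto simp: node_weight_cost_def K_edges_def)

text \<open>On \<open>E\<close> the cost is not defined as a minimum, so the bound comes from the
  two ends of the walk; for other pairs the walk is first reduced to a path.\<close>

lemma node_weight_cost_le_walk:
  assumes "p \<noteq> []" "set (walk_edges p) \<subseteq> E"
  shows "node_weight_cost E f $ {hd p, last p} \<le> walk_weight (sum f) p"
proof -
  have s0: "sum f e \<ge> 0" for e by (simp add: sum_nonneg f0)
  show ?thesis
  proof (cases "hd p = last p")
    case True
    then show ?thesis using walk_weight_nonneg[of "sum f" p] s0
      by (simp add: node_weight_cost_singleton)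
  next
    case False
    show ?thesis
    proof (cases "{hd p, last p} \<in> E")
      case True
      have "length p \<ge> 2" using False assms(1) by (cases p rule: walk_edges.cases) auto
      then have "walk_weight (sum f) p \<ge> f (hd p) + f (last p)"
        using assms(2) EK f0 by (intro walk_weight_ge_ends) auto
      then show ?thesis using True False by (simp add: node_weight_cost_def)
    next
      case notE: False
      obtain q where q: "is_path E (hd p) q (last p)" "walk_weight (sum f) q \<le> walk_weight (sum f) p"
        using walk_to_path[of p E "sum f"] assms s0 by blast
      have "node_weight_cost E f $ {hd p, last p} \<le> path_cost f q"
        using False notE q(1) finite_path_costs[of f "{hd p, last p}" E]
        by (simp add: node_weight_cost_def) (intro Min_le, auto)
      then show ?thesis using q(2) by (simp add: path_cost_eq_walk_weight)
    qed
  qed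
qed

lemma node_weight_cost_attained:
  obtains p where "p \<noteq> []" "hd p = u" "last p = v" "set (walk_edges p) \<subseteq> E"
    "walk_weight (sum f) p = node_weight_cost E f $ {u, v}"
proof (cases "u = v \<or> {u, v} \<in> E")
  case True
  show ?thesis
  proof (cases "u = v")
    case True
    then show ?thesis using that[of "[u]"] by (simp add: node_weight_cost_singleton)
  next
    case False
    with \<open>u = v \<or> {u, v} \<in> E\<close> show ?thesis
      using that[of "[u, v]"] by (simp add: node_weight_cost_def)
  qed
next
  case False
  let ?A = "{path_cost f p | a b p. {u, v} = {a, b} \<and> is_path E a p b}"
  obtain p where "is_path E u p v" using conn unfolding graph_connected_def by blast
  then have "?A \<noteq> {}" by blast
  then have "Min ?A \<in> ?A" using finite_path_costs by (intro Min_in)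
  then obtain a b p where p: "Min ?A = path_cost f p" "{u, v} = {a, b}" "is_path E a p b" by blast
  have c: "node_weight_cost E f $ {u, v} = walk_weight (sum f) p"
    using False p(1) by (simp add: node_weight_cost_def path_cost_eq_walk_weight)
  from p(2) consider "a = u" "b = v" | "a = v" "b = u" by (auto simp: doubleton_eq_iff)
  then show ?thesis
  proof cases
    case 1
    then show ?thesis using that[of p] p(3) c by (auto simp: is_path_def)
  next
    \<comment> \<open>The minimum ranges over both orientations of the pair, so the optimal path may
      have to be reversed.\<close>
    case 2
    then show ?thesis using that[of "rev p"] p(3) c
      by (auto simp: is_path_def hd_rev last_rev walk_edges_rev walk_weight_def sum_list_rev simp flip: rev_map)
  qed
qed

text \<open>Optimal walks are concatenated. The result may repeat nodes, which is why the upper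
  bound was proved for walks.\<close>

lemma node_weight_cost_triangle:
  "node_weight_cost E f $ {u, x} \<le> node_weight_cost E f $ {u, v} + node_weight_cost E f $ {v, x}"
proof -
  obtain p where p: "p \<noteq> []" "hd p = u" "last p = v" "set (walk_edges p) \<subseteq> E"
    "walk_weight (sum f) p = node_weight_cost E f $ {u, v}" by (rule node_weight_cost_attained)
  obtain q where q: "q \<noteq> []" "hd q = v" "last q = x" "set (walk_edges q) \<subseteq> E"
    "walk_weight (sum f) q = node_weight_cost E f $ {v, x}" by (rule node_weight_cost_attained)
  obtain p' where p': "p = p' @ [v]" using p by (metis append_butlast_last_id)
  obtain q' where q': "q = v # q'" using q by (metis list.collapse)
  let ?r = "p' @ v # q'"
  have "set (walk_edges ?r) \<subseteq> E"
    using walk_edges_append[of p' v q'] p(4) q(4) by (simp add: p' q')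
  then have "node_weight_cost E f $ {hd ?r, last ?r} \<le> walk_weight (sum f) ?r"
    by (intro node_weight_cost_le_walk) auto
  moreover have "hd ?r = u" using p(2) unfolding p' by (cases p') auto
  moreover have "last ?r = x" using q(3) unfolding q' by simp
  ultimately show ?thesis
    using walk_weight_append[of "sum f" p' v q'] p(5) q(5) by (simp add: p' q')
qed

lemma node_weight_cost_ge:
  assumes "e \<in> K_edges"
  shows "node_weight_cost E f $ e \<ge> sum f e"
proof -
  obtain u v where e: "e = {u, v}" "u \<noteq> v" using assms by (auto simp: K_edges_def card_2_iff)
  obtain p where p: "p \<noteq> []" "hd p = u" "last p = v" "set (walk_edges p) \<subseteq> E"
    "walk_weight (sum f) p = node_weight_cost E f $ {u, v}" by (rule node_weight_cost_attained)
  have "length p \<ge> 2" using p e(2) by (cases p rule: walk_edges.cases) auto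
  then have "walk_weight (sum f) p \<ge> f (hd p) + f (last p)"
    using p(4) EK f0 by (intro walk_weight_ge_ends) auto
  then show ?thesis using p e by simp
qed

lemma node_weight_cost_nonneg: "node_weight_cost E f $ e \<ge> 0"
proof (cases "e \<in> K_edges")
  case True
  have "sum f e \<ge> 0" by (simp add: sum_nonneg f0)
  then show ?thesis using node_weight_cost_ge[OF True] by simp
next
  case False
  then show ?thesis using EK by (auto simp: node_weight_cost_def)
qed

end

section \<open>The subtour relaxation\<close>

text \<open>Double counting of incidences: each node collects the values of its incident edges, so
  degree conditions evaluate the cost.\<close>

lemma sum_edges_eq_sum_nodes:
  fixes f :: "'v::finite \<Rightarrow> real"
  shows "(\<Sum>e\<in>A. sum f e * x e) = (\<Sum>v\<in>UNIV. f v * (\<Sum>e | e \<in> A \<and> v \<in> e. x e))"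
proof -
  have "(\<Sum>e\<in>A. sum f e * x e) = (\<Sum>e\<in>A. \<Sum>v | v \<in> UNIV \<and> v \<in> e. f v * x e)"
    by (simp add: sum_distrib_right)
  also have "\<dots> = (\<Sum>v\<in>UNIV. \<Sum>e | e \<in> A \<and> v \<in> e. f v * x e)"
    by (rule sum.swap_restrict) auto
  finally show ?thesis by (simp add: sum_distrib_left)
qed

lemma cut_singleton: "cut {v} = {e \<in> K_edges. v \<in> e}"
proof -
  have "card (e \<inter> {v}) = 1 \<longleftrightarrow> v \<in> e" for e
    by (cases "v \<in> e") simp_all
  then show ?thesis by (simp add: cut_def)
qed

lemma vsum_everywhere: "vsum (everywhere l E) F = l * card (E \<inter> F)"
proof -
  have "vsum (everywhere l E) F = (\<Sum>e\<in>E \<inter> F. l)"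
    unfolding vsum_def everywhere_def by (simp add: sum.If_cases Int_commute)
  then show ?thesis by simp
qed

text \<open>Deleting a cut of at most two edges would leave the graph connected, although no edge
  leaves \<open>S\<close> any more.\<close>

lemma card_cut_ge_3:
  fixes E :: "'v::finite set set"
  assumes "edge_connected 3 E" "E \<subseteq> K_edges" "S \<noteq> {}" "S \<noteq> UNIV"
  shows "card (E \<inter> cut S) \<ge> 3"
proof (rule ccontr)
  assume "\<not> ?thesis"
  then have "graph_connected (E - E \<inter> cut S)"
    using assms(1) by (auto simp: edge_connected_def)
  then obtain a b where ab: "a \<in> S" "b \<notin> S" "{a, b} \<in> E - E \<inter> cut S"
    using connected_crosses assms(3,4) by blast
  then have "{a, b} \<inter> S = {a}" by auto
  then show False using ab assms(2) by (auto simp: cut_def)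
qed

text \<open>The value \<open>2/3\<close> makes three edges sum to 2, which settles both the degree
  equations and the cuts with at least three edges.\<close>

lemma everywhere_two_thirds_feasible:
  assumes "E \<subseteq> K_edges" "cubic E" "edge_connected 3 E"
  shows "everywhere (2/3) E \<in> subtour_polytope"
proof -
  have "E \<inter> cut {v} = {e \<in> E. v \<in> e}" for v
    using assms(1) by (auto simp: cut_singleton)
  then have "vsum (everywhere (2/3) E) (cut {v}) = 2" for v
    using assms(2) by (simp add: vsum_everywhere cubic_def)
  moreover have "vsum (everywhere (2/3) E) (cut S) \<ge> 2" if "S \<noteq> {}" "S \<subset> UNIV" for S
  proof -
    have "card (E \<inter> cut S) \<ge> 3"
      using card_cut_ge_3[OF assms(3,1)] that by blast
    then show ?thesis by (simp add: vsum_everywhere)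
  qed
  ultimately show ?thesis
    using assms(1) unfolding subtour_polytope_def by (auto simp: everywhere_def)
qed

lemma everywhere_cost:
  assumes "cubic E"
  shows "node_weight_cost E f \<bullet> everywhere l E = 3 * l * (\<Sum>v\<in>UNIV. f v)"
proof -
  have "node_weight_cost E f \<bullet> everywhere l E
      = (\<Sum>e\<in>UNIV. if e \<in> E then sum f e * l else 0)"
    unfolding inner_vec_def by (intro sum.cong) (auto simp: everywhere_def node_weight_cost_def)
  also have "\<dots> = (\<Sum>e\<in>E. sum f e * l)" by (simp add: sum.If_cases)
  also have "\<dots> = (\<Sum>v\<in>UNIV. f v * (3 * l))"
    using assms by (simp add: sum_edges_eq_sum_nodes cubic_def)
  finally show ?thesis by (simp add: sum_distrib_right[symmetric])
qed

text \<open>The value is shown to be attained and to be a lower bound, so the \<open>LEAST\<close>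
  over the reals exists.\<close>

lemma LP_node_weight_cost:
  assumes "E \<subseteq> K_edges" "cubic E" "edge_connected 3 E" "graph_connected E" "\<And>v. f v \<ge> 0"
  shows "LP (node_weight_cost E f) = 2 * (\<Sum>v\<in>UNIV. f v)"
  unfolding LP_def
proof (rule Least_equality)
  let ?c = "node_weight_cost E f"
  have "(\<Sum>e\<in>K_edges. ?c $ e * everywhere (2/3) E $ e) = ?c \<bullet> everywhere (2/3) E"
    unfolding inner_vec_def using assms(1)
    by (intro sum.mono_neutral_cong_left) (auto simp: everywhere_def)
  then show "\<exists>x\<in>subtour_polytope. 2 * (\<Sum>v\<in>UNIV. f v) = (\<Sum>e\<in>K_edges. ?c $ e * x $ e)"
    using everywhere_two_thirds_feasible[OF assms(1-3)] everywhere_cost[OF assms(2), of f "2/3"]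
    by (intro bexI[of _ "everywhere (2/3) E"]) auto
next
  let ?c = "node_weight_cost E f"
  fix r assume "\<exists>x\<in>subtour_polytope. r = (\<Sum>e\<in>K_edges. ?c $ e * x $ e)"
  then obtain x where x: "x \<in> subtour_polytope" and r: "r = (\<Sum>e\<in>K_edges. ?c $ e * x $ e)" by blast
  have "(\<Sum>e | e \<in> K_edges \<and> v \<in> e. x $ e) = 2" for v
    using x by (auto simp: subtour_polytope_def vsum_def cut_singleton)
  \<comment> \<open>By the degree equations every \<open>f v\<close> is counted with total weight
    2.\<close>
  then have "2 * (\<Sum>v\<in>UNIV. f v) = (\<Sum>e\<in>K_edges. sum f e * x $ e)"
    unfolding sum_edges_eq_sum_nodes by (simp add: mult.commute[of 2] sum_distrib_right)
  also have "\<dots> \<le> r" unfolding r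
    using x assms by (intro sum_mono mult_right_mono node_weight_cost_ge)
      (auto simp: subtour_polytope_def)
  finally show "2 * (\<Sum>v\<in>UNIV. f v) \<le> r" .
qed

section \<open>Size of the graph, a cheap tour in the hull, and the final bound\<close>

lemma cubic_card_ge_3:
  assumes "E \<subseteq> K_edges" "cubic (E :: 'v::finite set set)"
  shows "CARD('v) \<ge> 3"
proof -
  fix v :: 'v
  \<comment> \<open>A crude count that includes \<open>w = v\<close>; it already gives the three
    nodes that \<open>hamiltonian_cycle\<close> asks for.\<close>
  have "{e \<in> E. v \<in> e} \<subseteq> (\<lambda>w. {v, w}) ` UNIV"
  proof
    fix e assume "e \<in> {e \<in> E. v \<in> e}"
    then obtain w where "e = {v, w}" using assms(1) K_edgesE by blast
    then show "e \<in> (\<lambda>w. {v, w}) ` UNIV" by blast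
  qed
  then have "card {e \<in> E. v \<in> e} \<le> CARD('v)"
    by (rule surj_card_le[rotated]) simp
  then show ?thesis using assms(2) by (simp add: cubic_def)
qed

text \<open>If every tour cost strictly more than \<open>y\<close>, an open half-space would contain
  the hull, and hence \<open>y\<close>, but not \<open>y\<close>.\<close>

lemma tour_le_hull_point:
  assumes "y \<in> tour_polyhedron"
  obtains J where "is_tour J" "c \<bullet> incidence_vector J \<le> c \<bullet> y"
proof -
  have False if "\<And>J. is_tour J \<Longrightarrow> c \<bullet> incidence_vector J > c \<bullet> y"
  proof -
    have "tour_polyhedron \<subseteq> {z. c \<bullet> z > c \<bullet> y}"
      unfolding tour_polyhedron_def
      by (rule hull_minimal) (use that in \<open>auto intro: convex_halfspace_gt\<close>)
    then show False using assms by auto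
  qed
  then show ?thesis using that not_le by blast
qed

theorem theorem5:
  fixes E :: "'v::finite set set" and f :: "'v \<Rightarrow> real" and l :: real
  assumes "E \<subseteq> K_edges"
    and "cubic E"
    and "edge_connected 3 E"
    and "\<forall>v. f v \<ge> 0"
    and "everywhere l E \<in> tour_polyhedron"
  shows "OPT (node_weight_cost E f) \<le> 3 / 2 * l * LP (node_weight_cost E f)"
proof -
  let ?c = "node_weight_cost E f"
  \<comment> \<open>This is edge connectivity with the empty set deleted.\<close>
  have conn: "graph_connected E"
    using assms(3) unfolding edge_connected_def by (metis Diff_empty card.empty empty_subsetI zero_less_numeral)
  have f0: "\<And>v. f v \<ge> 0" using assms(4) by blast
  obtain J where J: "is_tour J" "?c \<bullet> incidence_vector J \<le> ?c \<bullet> everywhere l E"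
    using tour_le_hull_point[OF assms(5)] by blast
  have "OPT ?c \<le> ?c \<bullet> incidence_vector J"
    using J(1) cubic_card_ge_3[OF assms(1,2)]
      node_weight_cost_nonneg[OF assms(1) conn f0] node_weight_cost_triangle[OF assms(1) conn f0]
    by (rule OPT_le_tour)
  also have "\<dots> \<le> 3 * l * (\<Sum>v\<in>UNIV. f v)"
    using J(2) everywhere_cost[OF assms(2)] by simp
  \<comment> \<open>The LP value is twice the node sum, so \<open>3 * l\<close> times that sum is
    \<open>3 / 2 * l\<close> times the LP value.\<close>
  finally show ?thesis
    using LP_node_weight_cost[OF assms(1-3) conn f0] by simp
qed

end
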